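(* Let $(X,d,\mu)$ be a quasi-metric space equipped with a nonnegative Borel measure, and let $\alpha,p\in(0,\infty)$ and $q\in(0,\infty]$. Then the following are equivalent: (1) The embedding $N^\alpha_{p,q}(X,d,\mu)\hookrightarrow L^p(X,\mu)$ is compact. (2) For all $\beta\in(0,\alpha)$ and $r\in(0,\infty]$ the embeddings $N^\alpha_{p,q}(X,d,\mu)\hookrightarrow M^\beta_{p,r}(X,d,\mu)$ and $N^\alpha_{p,q}(X,d,\mu)\hookrightarrow N^\beta_{p,r}(X,d,\mu)$ are compact. (3) There exist $\beta\in(0,\alpha)$ and $r\in(0,\infty]$ such that at least one of the embeddings $N^\alpha_{p,q}(X,d,\mu)\hookrightarrow M^\beta_{p,r}(X,d,\mu)$ or $N^\alpha_{p,q}(X,d,\mu)\hookrightarrow N^\beta_{p,r}(X,d,\mu)$ is compact.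
   Context: A quasi-metric space $(X,d)$ is a set $X$ with at least two elements and a function $d:X\times X\to[0,\infty)$ for which there are constants $C_0,C_1\in(0,\infty)$ such that for all $x,y,z\in X$: $d(x,y)=0$ iff $x=y$; $d(y,x)\le C_0 d(x,y)$; $d(x,y)\le C_1\max\{d(x,z),d(z,y)\}$ (symmetry is not required). $B_d(x,r):=\{y\in X:d(x,y)<r\}$. The topology $\tau_d$ consists of all $\mathcal O\subseteq X$ such that for each $x\in\mathcal O$ there is $r>0$ with $B_d(x,r)\subseteq\mathcal O$. A Borel measure is a measure on a $\sigma$-algebra containing the Borel sets of $\tau_d$. Fractional gradients: for $\alpha\in(0,\infty)$ and measurable $u:X\to\mathbb R$, $\mathbb D^\alpha_d(u)$ is the set of sequences $\vec g=\{g_k\}_{k\in\mathbb Z}$ of nonnegative measurable functions on $X$ for which there is a measurable $E$ with $\mu(E)=0$ and $|u(x)-u(y)|\le[d(x,y)]^\alpha(g_k(x)+g_k(y))$ for all $k\in\mathbb Z$ and $x,y\in X\setminus E$ with $2^{-k-1}\le d(x,y)<2^{-k}$. The Hajłasz–Triebel–Lizorkin space $M^\alpha_{p,q}(X,d,\mu)$ is the set of $u\in L^p(X,\mu)$ with finite (quasi-)norm $\|u\|_{L^p(X,\mu)}+\inf_{\vec g\in\mathbb D^\alpha_d(u)}\big\|\,\|\{g_k\}_k\|_{\ell^q(\mathbb Z)}\big\|_{L^p(X,\mu)}$; the Hajłasz–Besov space $N^\alpha_{p,q}(X,d,\mu)$ is the set of $u\in L^p(X,\mu)$ with finite (quasi-)norm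 $\|u\|_{L^p(X,\mu)}+\inf_{\vec g\in\mathbb D^\alpha_d(u)}\big\|\{\|g_k\|_{L^p(X,\mu)}\}_k\big\|_{\ell^q(\mathbb Z)}$. These are quasi-Banach spaces. An embedding is compact if the inclusion map is well defined and maps bounded sets to totally bounded (equivalently, relatively compact) sets. *)

theory Defs
  imports "HOL-Analysis.Analysis"
begin

definition quasi_metric_space :: "'a set \<Rightarrow> ('a \<Rightarrow> 'a \<Rightarrow> real) \<Rightarrow> bool" where
  "quasi_metric_space X d \<longleftrightarrow>
     (\<exists>x\<in>X. \<exists>y\<in>X. x \<noteq> y) \<and>
     (\<forall>x\<in>X. \<forall>y\<in>X. 0 \<le> d x y) \<and>
     (\<forall>x\<in>X. \<forall>y\<in>X. d x y = 0 \<longleftrightarrow> x = y) \<and>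
     (\<exists>C0>0. \<forall>x\<in>X. \<forall>y\<in>X. d y x \<le> C0 * d x y) \<and>
     (\<exists>C1>0. \<forall>x\<in>X. \<forall>y\<in>X. \<forall>z\<in>X. d x y \<le> C1 * max (d x z) (d z y))"

definition qball :: "'a set \<Rightarrow> ('a \<Rightarrow> 'a \<Rightarrow> real) \<Rightarrow> 'a \<Rightarrow> real \<Rightarrow> 'a set" where
  "qball X d x r = {y \<in> X. d x y < r}"

(* The balls themselves need be neither open nor measurable. *)
definition qtopology :: "'a set \<Rightarrow> ('a \<Rightarrow> 'a \<Rightarrow> real) \<Rightarrow> 'a topology" where
  "qtopology X d = topology (\<lambda>U. U \<subseteq> X \<and> (\<forall>x\<in>U. \<exists>r>0. qball X d x r \<subseteq> U))"

lemma openin_qtopology: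
  "openin (qtopology X d) U \<longleftrightarrow> U \<subseteq> X \<and> (\<forall>x\<in>U. \<exists>r>0. qball X d x r \<subseteq> U)"
proof -
  have "istopology (\<lambda>U. U \<subseteq> X \<and> (\<forall>x\<in>U. \<exists>r>0. qball X d x r \<subseteq> U))"
    unfolding istopology_def
  proof (intro conjI allI impI)
    fix S T assume S: "S \<subseteq> X \<and> (\<forall>x\<in>S. \<exists>r>0. qball X d x r \<subseteq> S)"
      and T: "T \<subseteq> X \<and> (\<forall>x\<in>T. \<exists>r>0. qball X d x r \<subseteq> T)"
    show "S \<inter> T \<subseteq> X" using S by blast
    show "\<forall>x\<in>S \<inter> T. \<exists>r>0. qball X d x r \<subseteq> S \<inter> T"
    proof
      fix x assume "x \<in> S \<inter> T"
      then obtain r s where "r > 0" "qball X d x r \<subseteq> S" "s > 0" "qball X d x s \<subseteq> T"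
        using S T by blast
      then have "min r s > 0" "qball X d x (min r s) \<subseteq> S \<inter> T"
        by (auto simp: qball_def)
      then show "\<exists>r>0. qball X d x r \<subseteq> S \<inter> T" by blast
    qed
  next
    fix K assume K: "\<forall>S\<in>K. S \<subseteq> X \<and> (\<forall>x\<in>S. \<exists>r>0. qball X d x r \<subseteq> S)"
    then show "\<Union>K \<subseteq> X" by blast
    show "\<forall>x\<in>\<Union>K. \<exists>r>0. qball X d x r \<subseteq> \<Union>K"
    proof
      fix x assume "x \<in> \<Union>K"
      then obtain S where S: "S \<in> K" "x \<in> S" by blast
      then obtain r where "r > 0" "qball X d x r \<subseteq> S" using K by meson
      then show "\<exists>r>0. qball X d x r \<subseteq> \<Union>K" using S(1) by blast
    qed
  qed
  then show ?thesis
    by (simp add: qtopology_def topology_inverse')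
qed

definition quasi_metric_measure_space ::
    "'a set \<Rightarrow> ('a \<Rightarrow> 'a \<Rightarrow> real) \<Rightarrow> 'a measure \<Rightarrow> bool" where
  "quasi_metric_measure_space X d M \<longleftrightarrow>
     quasi_metric_space X d \<and> space M = X \<and>
     sigma_sets X {U. openin (qtopology X d) U} \<subseteq> sets M"

text \<open>Powers of extended nonnegative reals, for positive exponents only.\<close>

definition enn_powr :: "ennreal \<Rightarrow> real \<Rightarrow> ennreal" where
  "enn_powr x a = (if x = \<infinity> then \<infinity> else ennreal (enn2real x powr a))"

definition Lp_norm :: "'a measure \<Rightarrow> real \<Rightarrow> ('a \<Rightarrow> ennreal) \<Rightarrow> ennreal" where
  "Lp_norm M p f = enn_powr (\<integral>\<^sup>+x. enn_powr (f x) p \<partial>M) (1 / p)"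

definition lq_norm :: "ennreal \<Rightarrow> (int \<Rightarrow> ennreal) \<Rightarrow> ennreal" where
  "lq_norm q a = (if q = \<infinity> then (SUP k. a k) else Lp_norm (count_space UNIV) (enn2real q) a)"

text \<open>
  A function space is a set of real-valued functions together with an extended-valued
  (quasi-)norm functional. Elements are represented by functions instead of almost-everywhere
  equivalence classes: membership and the functionals below depend only on the class, so
  boundedness and total boundedness mean the same for either representation.
\<close>

type_synonym 'a fun_space = "('a \<Rightarrow> real) set \<times> (('a \<Rightarrow> real) \<Rightarrow> ennreal)"

definition Lp_space :: "'a measure \<Rightarrow> real \<Rightarrow> 'a fun_space" where
  "Lp_space M p =
    (let nrm = (\<lambda>u. Lp_norm M p (\<lambda>x. ennreal \<bar>u x\<bar>))
     in ({u \<in> borel_measurable M. nrm u < \<infinity>}, nrm))"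

definition frac_gradients ::
    "('a \<Rightarrow> 'a \<Rightarrow> real) \<Rightarrow> 'a measure \<Rightarrow> real \<Rightarrow> ('a \<Rightarrow> real) \<Rightarrow> (int \<Rightarrow> 'a \<Rightarrow> real) set" where
  "frac_gradients d M \<alpha> u =
     {g. (\<forall>k. g k \<in> borel_measurable M \<and> (\<forall>x\<in>space M. 0 \<le> g k x)) \<and>
         (\<exists>E\<in>null_sets M. \<forall>k. \<forall>x\<in>space M - E. \<forall>y\<in>space M - E.
            2 powi (- k - 1) \<le> d x y \<and> d x y < 2 powi (- k) \<longrightarrow>
            \<bar>u x - u y\<bar> \<le> d x y powr \<alpha> * (g k x + g k y))}"

text \<open>In the next two definitions the infimum over an empty set of gradients is \<open>\<infinity>\<close>.\<close>

definition Hajlasz_Triebel_Lizorkin ::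
    "('a \<Rightarrow> 'a \<Rightarrow> real) \<Rightarrow> 'a measure \<Rightarrow> real \<Rightarrow> real \<Rightarrow> ennreal \<Rightarrow> 'a fun_space" where
  "Hajlasz_Triebel_Lizorkin d M \<alpha> p q =
    (let nrm = (\<lambda>u. snd (Lp_space M p) u +
            (INF g\<in>frac_gradients d M \<alpha> u.
               Lp_norm M p (\<lambda>x. lq_norm q (\<lambda>k. ennreal (g k x)))))
     in ({u \<in> fst (Lp_space M p). nrm u < \<infinity>}, nrm))"

definition Hajlasz_Besov ::
    "('a \<Rightarrow> 'a \<Rightarrow> real) \<Rightarrow> 'a measure \<Rightarrow> real \<Rightarrow> real \<Rightarrow> ennreal \<Rightarrow> 'a fun_space" where
  "Hajlasz_Besov d M \<alpha> p q =
    (let nrm = (\<lambda>u. snd (Lp_space M p) u +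
            (INF g\<in>frac_gradients d M \<alpha> u.
               lq_norm q (\<lambda>k. Lp_norm M p (\<lambda>x. ennreal (g k x)))))
     in ({u \<in> fst (Lp_space M p). nrm u < \<infinity>}, nrm))"

definition bounded_in :: "'a fun_space \<Rightarrow> ('a \<Rightarrow> real) set \<Rightarrow> bool" where
  "bounded_in A S \<longleftrightarrow> S \<subseteq> fst A \<and> (\<exists>C::real. \<forall>u\<in>S. snd A u \<le> ennreal C)"

definition totally_bounded_in :: "'a fun_space \<Rightarrow> ('a \<Rightarrow> real) set \<Rightarrow> bool" where
  "totally_bounded_in A S \<longleftrightarrow> S \<subseteq> fst A \<and>
     (\<forall>\<epsilon>::real. \<epsilon> > 0 \<longrightarrow>
        (\<exists>F. finite F \<and> F \<subseteq> fst A \<and> (\<forall>u\<in>S. \<exists>v\<in>F. snd A (\<lambda>x. u x - v x) < ennreal \<epsilon>)))"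

definition compact_embedding :: "'a fun_space \<Rightarrow> 'a fun_space \<Rightarrow> bool" where
  "compact_embedding A B \<longleftrightarrow>
     fst A \<subseteq> fst B \<and> (\<forall>S. bounded_in A S \<longrightarrow> totally_bounded_in B S)"

end

theory Submission
  imports Defs
begin

text \<open>
  The Hajlasz norms dominate the $L^p$ norm, so a compact embedding into any of the target spaces
  restricts to one into $L^p$. The substance is the converse, that total boundedness in $L^p$
  of a set bounded in $N^\alpha_{p,q}$ improves to total boundedness at smoothness \<open>\<beta> < \<alpha>\<close>.

  This rests on an interpolation principle: among functions \<open>w\<close> possessing an \<open>\<alpha>\<close>-gradient \<open>g\<close>
  with $\|g_k\|_{L^p}$ bounded uniformly in \<open>k\<close>, a small $L^p$ norm forces small \<open>\<beta>\<close>-norms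
  (\<open>Hajlasz_norm_small\<close>). At a fine scale $d(x,y) \sim 2^{-k}$ with \<open>k \<ge> n\<close>, the function
  $2^{-k(\alpha-\beta)} g_k$ serves as a \<open>\<beta>\<close>-gradient; at a coarse scale the trivial bound
  $|w(x)-w(y)| \le |w(x)|+|w(y)|$ makes a multiple of $|w|$ serve. Part of the available decay is
  spent on absorbing all scales into one single function \<open>\<Psi>\<close>,
  \[ \Psi^p = (K|w|)^p + \sum_{k\ge n} (2^{-\eta k} g_k)^p, \qquad
     \eta = \min(\beta,\alpha-\beta)/2, \]
  and the rest is kept, so that $h_k = 2^{-\eta|k|}\Psi$ is a \<open>\<beta>\<close>-gradient of \<open>w\<close>
  (\<open>geometric_decay_gradient\<close>). A gradient that is a product of a sequence and a function has the
  same Besov and Triebel-Lizorkin size, namely the $\ell^r$ norm of the sequence times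
  $\|\Psi\|_{L^p}$. Both targets and all exponents \<open>r\<close> are therefore treated at once. Finally
  $\|\Psi\|_{L^p}^p$ is at most $K^p\|w\|_{L^p}^p$ plus the tail of a geometric series; one makes
  the tail small by choosing \<open>n\<close>, and then the first term by smallness of $\|w\|_{L^p}$.

  To conclude, a finite $L^p$ net of a set bounded in $N^\alpha_{p,q}$ is moved into the set
  itself (\<open>compact_embedding_from_Lp\<close>). Then the differences \<open>u - v\<close> between points and centres
  have uniformly bounded gradients, and the principle applies to them.
\<close>

section \<open>Powers and $L^p$ functionals\<close>

lemma enn_powr_ennreal: "0 \<le> x \<Longrightarrow> enn_powr (ennreal x) a = ennreal (x powr a)"
  by (simp add: enn_powr_def)

lemma enn_powr_mono:
  assumes "0 < a" "x \<le> y"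
  shows "enn_powr x a \<le> enn_powr y a"
proof (cases "y = \<infinity>")
  case False
  then have "y < top" "x < top" using assms(2) by (auto simp: top.not_eq_extremum le_less_trans)
  then show ?thesis using assms
    by (auto simp: enn_powr_def intro!: ennreal_leI powr_mono2 enn2real_mono)
qed (simp add: enn_powr_def)

lemma enn_powr_mult:
  assumes "0 < a"
  shows "enn_powr (x * y) a = enn_powr x a * enn_powr y a"
proof -
  have inf: "enn_powr (top * z) a = enn_powr top a * enn_powr z a" for z
  proof (cases "z = 0")
    case False
    then have "enn_powr z a \<noteq> 0" by (cases z) (auto simp: enn_powr_def)
    then show ?thesis using False by (simp add: ennreal_top_mult) (simp add: enn_powr_def ennreal_top_mult)
  qed (simp add: enn_powr_def)
  consider "x = top" | "y = top" | r s where "x = ennreal r" "0 \<le> r" "y = ennreal s" "0 \<le> s"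
    by (metis ennreal_cases)
  then show ?thesis
  proof cases
    case 1
    then show ?thesis by (simp only: inf)
  next
    case 2
    then show ?thesis by (metis inf mult.commute)
  next
    case 3
    then show ?thesis by (simp add: enn_powr_ennreal powr_mult flip: ennreal_mult)
  qed
qed

lemma enn_powr_inverse:
  assumes "0 < p"
  shows "enn_powr (enn_powr x p) (1 / p) = x" "enn_powr (enn_powr x (1 / p)) p = x"
  using assms by (cases x; auto simp: enn_powr_def powr_powr)+

lemma enn_powr_root_le_iff:
  assumes "0 < p" "0 \<le> C"
  shows "enn_powr x (1 / p) \<le> ennreal C \<longleftrightarrow> x \<le> ennreal (C powr p)"
  using enn_powr_mono[of p "enn_powr x (1 / p)" "ennreal C"]
    enn_powr_mono[of "1 / p" x "enn_powr (ennreal C) p"] assms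
  by (auto simp: enn_powr_inverse enn_powr_ennreal powr_powr)

lemma measurable_enn_powr [measurable]: "(\<lambda>x. enn_powr x a) \<in> borel_measurable borel"
  unfolding enn_powr_def by measurable

lemma Lp_norm_cmult:
  assumes "0 < p" and [measurable]: "f \<in> borel_measurable M"
  shows "Lp_norm M p (\<lambda>x. c * f x) = c * Lp_norm M p f"
  using assms(1)
  by (simp add: Lp_norm_def enn_powr_mult enn_powr_inverse nn_integral_cmult)

lemma lq_norm_multc:
  assumes "0 < q"
  shows "lq_norm q (\<lambda>k. a k * b) = lq_norm q a * b"
proof (cases "q = \<infinity>")
  case True
  then show ?thesis by (simp add: lq_norm_def SUP_mult_right_ennreal)
next
  case False
  then have "0 < enn2real q" using assms by (simp add: enn2real_positive_iff top.not_eq_extremum)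
  then have "lq_norm q (\<lambda>k. b * a k) = b * lq_norm q a"
    using False by (simp add: lq_norm_def Lp_norm_cmult)
  then show ?thesis by (simp add: mult.commute)
qed

text \<open>
  The embedding of $\ell^q$ into $\ell^\infty$. It turns a bound on the Besov norm into a bound on
  $\|g_k\|_{L^p}$ that is uniform over the scales.
\<close>

lemma le_lq_norm:
  assumes "0 < q"
  shows "a k \<le> lq_norm q a"
proof (cases "q = \<infinity>")
  case True
  then show ?thesis by (auto simp: lq_norm_def intro: SUP_upper)
next
  case False
  then have q: "0 < enn2real q" using assms by (simp add: enn2real_positive_iff top.not_eq_extremum)
  have "enn_powr (a k) (enn2real q)
      = (\<integral>\<^sup>+j. enn_powr (a j) (enn2real q) * indicator {k} j \<partial>count_space UNIV)"
    by simp
  also have "\<dots> \<le> (\<integral>\<^sup>+j. enn_powr (a j) (enn2real q) \<partial>count_space UNIV)"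
    by (intro nn_integral_mono) (simp split: split_indicator)
  finally have "enn_powr (enn_powr (a k) (enn2real q)) (1 / enn2real q) \<le> lq_norm q a"
    using False q by (auto simp: lq_norm_def Lp_norm_def intro!: enn_powr_mono)
  then show ?thesis using q by (simp add: enn_powr_inverse)
qed

text \<open>
  The \<open>p\<close>-th power of the $L^p$ quasi-norm. It is additive on sums of \<open>p\<close>-th powers, which lets
  the cases \<open>p < 1\<close> and \<open>p \<ge> 1\<close> be handled alike.
\<close>

definition power_integral :: "'a measure \<Rightarrow> real \<Rightarrow> ('a \<Rightarrow> real) \<Rightarrow> ennreal" where
  "power_integral M p f = (\<integral>\<^sup>+x. ennreal (\<bar>f x\<bar> powr p) \<partial>M)"

lemma Lp_norm_abs: "Lp_norm M p (\<lambda>x. ennreal \<bar>f x\<bar>) = enn_powr (power_integral M p f) (1 / p)"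
  by (simp add: Lp_norm_def power_integral_def enn_powr_ennreal)

lemma Lp_norm_nonneg:
  assumes "\<And>x. x \<in> space M \<Longrightarrow> 0 \<le> f x"
  shows "Lp_norm M p (\<lambda>x. ennreal (f x)) = enn_powr (power_integral M p f) (1 / p)"
  unfolding Lp_norm_def power_integral_def
  by (intro arg_cong2[where f=enn_powr] nn_integral_cong refl) (simp add: assms enn_powr_ennreal)

text \<open>
  A quasi-triangle inequality valid for every positive \<open>p\<close>: a sum of two nonnegative numbers is at
  most twice the larger one.
\<close>

lemma power_integral_add_le:
  assumes "0 < p" and [measurable]: "f \<in> borel_measurable M" "g \<in> borel_measurable M"
    and bound: "\<And>x. x \<in> space M \<Longrightarrow> \<bar>h x\<bar> \<le> \<bar>f x\<bar> + \<bar>g x\<bar>"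
  shows "power_integral M p h
    \<le> ennreal (2 powr p) * (power_integral M p f + power_integral M p g)"
proof -
  have pt: "\<bar>h x\<bar> powr p \<le> 2 powr p * (\<bar>f x\<bar> powr p + \<bar>g x\<bar> powr p)" if "x \<in> space M" for x
  proof -
    have "\<bar>h x\<bar> powr p \<le> (2 * max \<bar>f x\<bar> \<bar>g x\<bar>) powr p"
      using assms(1) bound[OF that] by (intro powr_mono2) auto
    also have "\<dots> = 2 powr p * max \<bar>f x\<bar> \<bar>g x\<bar> powr p" by (simp add: powr_mult)
    also have "\<dots> \<le> 2 powr p * (\<bar>f x\<bar> powr p + \<bar>g x\<bar> powr p)"
      by (intro mult_left_mono) (auto simp: max_def)
    finally show ?thesis .
  qed
  have "power_integral M p h \<le>
    (\<integral>\<^sup>+x. ennreal (2 powr p) * (ennreal (\<bar>f x\<bar> powr p) + ennreal (\<bar>g x\<bar> powr p)) \<partial>M)"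
    unfolding power_integral_def
    using pt by (intro nn_integral_mono)
      (simp add: ennreal_leI flip: ennreal_plus ennreal_mult)
  also have "\<dots> = ennreal (2 powr p) * (power_integral M p f + power_integral M p g)"
    unfolding power_integral_def by (subst nn_integral_cmult) (auto simp: nn_integral_add)
  finally show ?thesis .
qed

text \<open>
  For finite exponents the two-sided sequence is dominated by two geometric series, one over
  \<open>k \<ge> 0\<close> and one over \<open>k \<le> 0\<close>; the index 0 is counted twice, which is harmless for finiteness.
\<close>

lemma lq_norm_geometric_finite:
  assumes "0 < \<eta>" "0 < r"
  shows "lq_norm r (\<lambda>k. ennreal (2 powr (- \<eta> * \<bar>real_of_int k\<bar>))) < \<infinity>"
proof (cases "r = \<infinity>")
  case True
  have "ennreal (2 powr (- \<eta> * \<bar>real_of_int k\<bar>)) \<le> 1" for k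
    using assms(1) powr_mono[of "- \<eta> * \<bar>real_of_int k\<bar>" 0 2] by simp
  then have "(SUP k. ennreal (2 powr (- \<eta> * \<bar>real_of_int k\<bar>))) \<le> 1" by (intro SUP_least)
  then show ?thesis using True by (simp add: lq_norm_def le_less_trans[OF _ ennreal_one_less_top])
next
  case False
  define s where "s = enn2real r"
  have s: "0 < s"
    using False assms by (simp add: s_def enn2real_positive_iff top.not_eq_extremum)
  define f :: "int \<Rightarrow> ennreal" where "f k = ennreal (2 powr (- \<eta> * s * \<bar>real_of_int k\<bar>))" for k
  define \<theta> where "\<theta> = 2 powr (- \<eta> * s)"
  have \<theta>: "0 < \<theta>" "\<theta> < 1"
    using s assms powr_less_mono[of "- \<eta> * s" 0 2] by (auto simp: \<theta>_def)
  have fn: "f (int n) = ennreal (\<theta> ^ n)" "f (- int n) = ennreal (\<theta> ^ n)" for n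
    by (simp_all add: f_def \<theta>_def powr_powr flip: powr_realpow)
  have half: "(\<integral>\<^sup>+k. f k \<partial>count_space (range e)) < \<infinity>" if "inj e" "\<And>n. f (e n) = ennreal (\<theta> ^ n)"
    for e :: "nat \<Rightarrow> int"
  proof -
    have "(\<integral>\<^sup>+k. f k \<partial>count_space (range e)) = (\<integral>\<^sup>+n. f (e n) \<partial>count_space UNIV)"
      using that(1) by (intro nn_integral_bij_count_space[symmetric]) (simp add: inj_on_imp_bij_betw)
    also have "\<dots> = (\<Sum>n. ennreal (\<theta> ^ n))"
      by (simp add: that(2) nn_integral_count_space_nat)
    also have "\<dots> = ennreal (\<Sum>n. \<theta> ^ n)"
      using \<theta> by (intro suminf_ennreal2) (auto intro: summable_geometric)
    finally show ?thesis by simp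
  qed
  have cover: "(1::ennreal) \<le> indicator (range int) k + indicator (range (\<lambda>n. - int n)) k" for k
    by (cases k rule: int_cases2) (auto split: split_indicator)
  have "(\<integral>\<^sup>+k. f k \<partial>count_space UNIV)
      \<le> (\<integral>\<^sup>+k. f k * indicator (range int) k + f k * indicator (range (\<lambda>n. - int n)) k \<partial>count_space UNIV)"
    using mult_left_mono[OF cover] by (intro nn_integral_mono) (simp add: distrib_left)
  also have "\<dots> = (\<integral>\<^sup>+k. f k \<partial>count_space (range int)) + (\<integral>\<^sup>+k. f k \<partial>count_space (range (\<lambda>n. - int n)))"
    by (simp add: nn_integral_add nn_integral_count_space_indicator)
  also have "\<dots> < \<infinity>"
    using half[of int] half[of "\<lambda>n. - int n"] fn by (simp add: inj_on_def)
  finally have "(\<integral>\<^sup>+k. f k \<partial>count_space UNIV) < \<infinity>" .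
  then show ?thesis
    using False by (simp add: lq_norm_def Lp_norm_def enn_powr_ennreal powr_powr f_def mult_ac
        flip: s_def) (simp add: enn_powr_def)
qed


section \<open>Fractional gradients with geometric decay\<close>

lemma two_powi_eq_powr: "(2::real) powi k = 2 powr real_of_int k"
  by (simp add: powr_real_of_int')

lemma frac_gradientsI:
  assumes "\<And>k. g k \<in> borel_measurable M" "\<And>k x. x \<in> space M \<Longrightarrow> 0 \<le> g k x" "E \<in> null_sets M"
    and "\<And>k x y. \<lbrakk>x \<in> space M - E; y \<in> space M - E; 2 powi (- k - 1) \<le> d x y; d x y < 2 powi (- k)\<rbrakk>
        \<Longrightarrow> \<bar>u x - u y\<bar> \<le> d x y powr \<alpha> * (g k x + g k y)"
  shows "g \<in> frac_gradients d M \<alpha> u"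
  unfolding frac_gradients_def mem_Collect_eq
proof (intro conjI allI ballI bexI[OF _ assms(3)] impI)
qed (use assms(1,2,4) in blast)+

lemma frac_gradientsE:
  assumes "g \<in> frac_gradients d M \<alpha> u"
  obtains E where "E \<in> null_sets M"
    "\<And>k x y. \<lbrakk>x \<in> space M - E; y \<in> space M - E; 2 powi (- k - 1) \<le> d x y; d x y < 2 powi (- k)\<rbrakk>
        \<Longrightarrow> \<bar>u x - u y\<bar> \<le> d x y powr \<alpha> * (g k x + g k y)"
proof -
  from assms obtain E where "E \<in> null_sets M"
    "\<forall>k. \<forall>x\<in>space M - E. \<forall>y\<in>space M - E. 2 powi (- k - 1) \<le> d x y \<and> d x y < 2 powi (- k) \<longrightarrow>
            \<bar>u x - u y\<bar> \<le> d x y powr \<alpha> * (g k x + g k y)"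
    unfolding frac_gradients_def mem_Collect_eq by (elim conjE bexE)
  then show thesis by (intro that[of E]) simp_all
qed

lemma frac_gradients_measurable: "g \<in> frac_gradients d M \<alpha> u \<Longrightarrow> g k \<in> borel_measurable M"
  by (simp add: frac_gradients_def)

lemma frac_gradients_nonneg: "g \<in> frac_gradients d M \<alpha> u \<Longrightarrow> x \<in> space M \<Longrightarrow> 0 \<le> g k x"
  by (simp add: frac_gradients_def)

text \<open>
  Gradients add under differences. This lets estimates for one function be applied to the
  difference of two members of a bounded set.
\<close>

lemma frac_gradients_diff:
  assumes g: "g \<in> frac_gradients d M \<alpha> u" and h: "h \<in> frac_gradients d M \<alpha> v"
  shows "(\<lambda>k x. g k x + h k x) \<in> frac_gradients d M \<alpha> (\<lambda>x. u x - v x)"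
proof -
  obtain E where E: "E \<in> null_sets M"
    "\<And>k x y. \<lbrakk>x \<in> space M - E; y \<in> space M - E; 2 powi (- k - 1) \<le> d x y; d x y < 2 powi (- k)\<rbrakk>
        \<Longrightarrow> \<bar>u x - u y\<bar> \<le> d x y powr \<alpha> * (g k x + g k y)"
    by (rule frac_gradientsE[OF g]) (rule that; simp)
  obtain F where F: "F \<in> null_sets M"
    "\<And>k x y. \<lbrakk>x \<in> space M - F; y \<in> space M - F; 2 powi (- k - 1) \<le> d x y; d x y < 2 powi (- k)\<rbrakk>
        \<Longrightarrow> \<bar>v x - v y\<bar> \<le> d x y powr \<alpha> * (h k x + h k y)"
    by (rule frac_gradientsE[OF h]) (rule that; simp)
  show ?thesis
  proof (rule frac_gradientsI)
    show "E \<union> F \<in> null_sets M" using E(1) F(1) by (rule null_sets.Un)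
    fix k x y
    assume xy: "x \<in> space M - (E \<union> F)" "y \<in> space M - (E \<union> F)"
      and k: "2 powi (- k - 1) \<le> d x y" "d x y < 2 powi (- k)"
    have "\<bar>(u x - v x) - (u y - v y)\<bar> \<le> \<bar>u x - u y\<bar> + \<bar>v x - v y\<bar>" by simp
    also have "\<dots> \<le> d x y powr \<alpha> * (g k x + g k y) + d x y powr \<alpha> * (h k x + h k y)"
      using E(2)[OF _ _ k] F(2)[OF _ _ k] xy by (intro add_mono) auto
    finally show "\<bar>(u x - v x) - (u y - v y)\<bar> \<le> d x y powr \<alpha> * ((g k x + h k x) + (g k y + h k y))"
      by (simp add: algebra_simps)
  qed (use g h in \<open>simp_all add: borel_measurable_add frac_gradients_measurable frac_gradients_nonneg\<close>)
qed

text \<open>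
  The trade of smoothness for decay. Scales \<open>k \<ge> n\<close> gain the factor $2^{-k(\alpha-\beta)}$, which
  is at most $2^{-2\eta k}$: one factor $2^{-\eta k}$ makes the series in $\Psi^p$ converge with a
  tail of geometric order in \<open>n\<close>, the other remains in the new gradient. Scales \<open>k < n\<close> have
  $d(x,y)^\beta \ge 2^{-(k+1)\beta}$, and the constant of $|u|$ is chosen so large that the
  prescribed decay in $|k|$ is still available; for $k \to -\infty$ it is, because
  \<open>\<eta> \<le> \<beta>\<close>. The integer \<open>n\<close> is free: raising it shrinks the contribution of the gradient
  at the price of a larger factor on the $L^p$ part.
\<close>

lemma geometric_decay_gradient:
  fixes n :: nat
  assumes "0 < \<beta>" "\<beta> < \<alpha>" "0 < p"
    and u [measurable]: "u \<in> borel_measurable M" and uf: "power_integral M p u < \<infinity>"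
    and g: "g \<in> frac_gradients d M \<alpha> u"
    and gA: "\<And>k. power_integral M p (g k) \<le> ennreal A"
  defines "\<eta> \<equiv> min \<beta> (\<alpha> - \<beta>) / 2"
  obtains \<Psi> where "\<Psi> \<in> borel_measurable M" "\<And>x. 0 \<le> \<Psi> x"
    "(\<lambda>k x. 2 powr (- \<eta> * \<bar>real_of_int k\<bar>) * \<Psi> x) \<in> frac_gradients d M \<beta> u"
    "power_integral M p \<Psi> \<le> ennreal (2 powr (p * (\<beta> + (\<eta> + \<beta>) * n))) * power_integral M p u
        + ennreal ((2 powr (- \<eta> * p)) ^ n / (1 - 2 powr (- \<eta> * p))) * ennreal A"
proof -
  have \<eta>: "0 < \<eta>" "\<eta> \<le> \<beta>" "2 * \<eta> \<le> \<alpha> - \<beta>"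
    using assms(1,2) by (auto simp: \<eta>_def min_def)
  have gm [measurable]: "g k \<in> borel_measurable M" for k
    using g by (rule frac_gradients_measurable)
  obtain E where E: "E \<in> null_sets M"
    and gE: "\<And>k x y. \<lbrakk>x \<in> space M - E; y \<in> space M - E; 2 powi (- k - 1) \<le> d x y; d x y < 2 powi (- k)\<rbrakk>
        \<Longrightarrow> \<bar>u x - u y\<bar> \<le> d x y powr \<alpha> * (g k x + g k y)"
    by (rule frac_gradientsE[OF g]) (rule that; simp)
  define \<theta> where "\<theta> = 2 powr (- \<eta> * p)"
  have \<theta>: "0 < \<theta>" "\<theta> < 1"
    using \<eta> assms(3) powr_less_mono[of "- \<eta> * p" 0 2] by (auto simp: \<theta>_def)
  define K where "K = 2 powr (\<beta> + (\<eta> + \<beta>) * n)"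
  have K: "0 < K" by (simp add: K_def)
  define T where "T m x = 2 powr (- \<eta> * real (n + m)) * g (int (n + m)) x" for m x
  \<comment> \<open>The \<open>p\<close>-th power of the dominating function; being a sum of nonnegative terms, it may be
    infinite on a null set.\<close>
  define P where "P x = ennreal (\<bar>K * u x\<bar> powr p) + (\<Sum>m. ennreal (\<bar>T m x\<bar> powr p))" for x
  define \<Psi> where "\<Psi> x = enn2real (P x) powr (1 / p)" for x
  have Tm [measurable]: "T m \<in> borel_measurable M" for m unfolding T_def by measurable
  have Pm [measurable]: "P \<in> borel_measurable M" unfolding P_def by measurable
  have \<Psi>m: "\<Psi> \<in> borel_measurable M" unfolding \<Psi>_def by measurable
  have scale_integral: "power_integral M p (\<lambda>x. c * f x) = ennreal (c powr p) * power_integral M p f"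
    if "0 \<le> c" "f \<in> borel_measurable M" for c and f :: "'a \<Rightarrow> real"
    using that unfolding power_integral_def
    by (simp add: abs_mult powr_mult ennreal_mult nn_integral_cmult)
  have "(\<integral>\<^sup>+x. P x \<partial>M) = power_integral M p (\<lambda>x. K * u x) + (\<Sum>m. power_integral M p (T m))"
    unfolding P_def power_integral_def by (simp add: nn_integral_add nn_integral_suminf)
  also have "power_integral M p (\<lambda>x. K * u x)
      = ennreal (2 powr (p * (\<beta> + (\<eta> + \<beta>) * n))) * power_integral M p u"
    using scale_integral[of K u] K by (simp add: K_def powr_powr mult.commute)
  also have "(\<Sum>m. power_integral M p (T m)) \<le> (\<Sum>m. ennreal (\<theta> ^ n * \<theta> ^ m) * ennreal A)"
  proof (intro suminf_le)
    fix m
    have "(2 powr (- \<eta> * real (n + m))) powr p = \<theta> ^ (n + m)"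
      by (simp add: \<theta>_def powr_powr mult_ac flip: powr_realpow)
    then show "power_integral M p (T m) \<le> ennreal (\<theta> ^ n * \<theta> ^ m) * ennreal A"
      unfolding T_def using gA[of "int (n + m)"]
      by (subst scale_integral) (auto simp: power_add intro!: mult_left_mono)
  qed auto
  also have "(\<Sum>m. ennreal (\<theta> ^ n * \<theta> ^ m) * ennreal A) = ennreal (\<theta> ^ n / (1 - \<theta>)) * ennreal A"
  proof -
    have "(\<Sum>m. ennreal (\<theta> ^ n * \<theta> ^ m)) = ennreal (\<theta> ^ n / (1 - \<theta>))"
      using \<theta> geometric_sums[of \<theta>, THEN sums_mult, of "\<theta> ^ n"]
      by (intro suminf_ennreal_eq) auto
    then show ?thesis by (simp add: ennreal_suminf_multc)
  qed
  finally have Pint: "(\<integral>\<^sup>+x. P x \<partial>M) \<le> ennreal (2 powr (p * (\<beta> + (\<eta> + \<beta>) * n))) * power_integral M p u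
      + ennreal (\<theta> ^ n / (1 - \<theta>)) * ennreal A"
    by (simp add: add_left_mono)
  also have "\<dots> < \<infinity>" using uf by (simp add: ennreal_mult_less_top)
  finally have "AE x in M. P x \<noteq> \<infinity>"
    by (intro nn_integral_PInf_AE) auto
  then have N: "{x \<in> space M. P x = \<infinity>} \<in> null_sets M"
    by (simp add: AE_iff_null)
  define E' where "E' = E \<union> {x \<in> space M. P x = \<infinity>}"
  have E': "E' \<in> null_sets M" unfolding E'_def using E N by blast
  \<comment> \<open>Where \<open>P\<close> is finite, \<open>\<Psi>\<close> dominates every function whose \<open>p\<close>-th power is a summand of \<open>P\<close>.\<close>
  have root: "a \<le> \<Psi> x" if "P x \<noteq> \<infinity>" "ennreal (\<bar>a\<bar> powr p) \<le> P x" for a x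
  proof -
    have "\<bar>a\<bar> powr p \<le> enn2real (P x)"
      using that enn2real_mono[of "ennreal (\<bar>a\<bar> powr p)" "P x"] by (simp add: top.not_eq_extremum)
    then have "(\<bar>a\<bar> powr p) powr (1 / p) \<le> \<Psi> x"
      unfolding \<Psi>_def using assms(3) by (intro powr_mono2) auto
    then show ?thesis using assms(3) by (simp add: powr_powr)
  qed
  have \<Psi>u: "K * \<bar>u x\<bar> \<le> \<Psi> x" if "x \<in> space M - E'" for x
    using that by (intro root) (auto simp: E'_def P_def abs_mult)
  have \<Psi>T: "T m x \<le> \<Psi> x" if "x \<in> space M - E'" for m x
  proof (rule root)
    show "P x \<noteq> \<infinity>" using that by (auto simp: E'_def)
    have "(\<Sum>i\<in>{m}. ennreal (\<bar>T i x\<bar> powr p)) \<le> (\<Sum>i. ennreal (\<bar>T i x\<bar> powr p))"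
      by (rule sum_le_suminf) auto
    also have "\<dots> \<le> P x" unfolding P_def by (rule add_increasing) auto
    finally show "ennreal (\<bar>T m x\<bar> powr p) \<le> P x" by simp
  qed
  have grad: "\<bar>u x - u y\<bar> \<le> d x y powr \<beta> *
      (2 powr (- \<eta> * \<bar>real_of_int k\<bar>) * \<Psi> x + 2 powr (- \<eta> * \<bar>real_of_int k\<bar>) * \<Psi> y)"
    if xy: "x \<in> space M - E'" "y \<in> space M - E'" and k: "2 powi (- k - 1) \<le> d x y" "d x y < 2 powi (- k)"
    for k x y
  proof -
    let ?c = "2 powr (- \<eta> * \<bar>real_of_int k\<bar>)"
    have d: "2 powr (- real_of_int k - 1) \<le> d x y" "d x y < 2 powr (- real_of_int k)"
      using k by (simp_all add: two_powi_eq_powr)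
    have d0: "0 < d x y" using d(1) by (rule less_le_trans[rotated]) simp
    show ?thesis
    proof (cases "int n \<le> k")
      case True
      then obtain m where m: "k = int (n + m)" by (metis nonneg_int_cases add.commute diff_add_cancel diff_ge_0_iff_ge of_nat_add)
      have "d x y powr \<alpha> = d x y powr \<beta> * d x y powr (\<alpha> - \<beta>)"
        by (simp flip: powr_add)
      also have "\<dots> \<le> d x y powr \<beta> * (2 powr (- real_of_int k)) powr (\<alpha> - \<beta>)"
        using d d0 assms(2) by (intro mult_left_mono powr_mono2) auto
      also have "(2 powr (- real_of_int k)) powr (\<alpha> - \<beta>) \<le> ?c * ?c"
      proof -
        have "real k * (2 * \<eta>) \<le> real k * (\<alpha> - \<beta>)" for k :: nat
          using \<eta> by (intro mult_left_mono) auto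
        from this[of "n + m"] show ?thesis
          by (simp add: m powr_powr flip: powr_add) (simp add: algebra_simps)
      qed
      finally have dk: "d x y powr \<alpha> \<le> d x y powr \<beta> * (?c * ?c)"
        by (simp add: mult_left_mono)
      have "\<bar>u x - u y\<bar> \<le> d x y powr \<alpha> * (g k x + g k y)"
        using gE[OF _ _ k] xy by (simp add: E'_def)
      also have "\<dots> \<le> d x y powr \<beta> * (?c * ?c) * (g k x + g k y)"
        using dk xy frac_gradients_nonneg[OF g] by (intro mult_right_mono add_nonneg_nonneg) auto
      also have "\<dots> = d x y powr \<beta> * (?c * T m x + ?c * T m y)"
        by (simp add: T_def m algebra_simps)
      also have "\<dots> \<le> d x y powr \<beta> * (?c * \<Psi> x + ?c * \<Psi> y)"
        using \<Psi>T xy by (intro mult_left_mono add_mono) auto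
      finally show ?thesis .
    next
      case False
      \<comment> \<open>The exponent of 2 in \<open>K\<close> times the lower bound for the distance power times the decay
        factor. It determines the choice of \<open>K\<close>.\<close>
      have "0 \<le> \<beta> + (\<eta> + \<beta>) * n + (- real_of_int k - 1) * \<beta> - \<eta> * \<bar>real_of_int k\<bar>"
      proof (cases "0 \<le> k")
        case True
        have "0 \<le> (\<eta> + \<beta>) * (real n - real_of_int k)" using \<eta> False by simp
        then show ?thesis using True by (simp add: algebra_simps)
      next
        case neg: False
        have "0 \<le> (\<eta> + \<beta>) * n" using \<eta> by simp
        moreover have "\<eta> * (- real_of_int k) \<le> \<beta> * (- real_of_int k)"
          using \<eta> neg by (intro mult_right_mono) auto
        moreover have "\<beta> + (\<eta> + \<beta>) * n + (- real_of_int k - 1) * \<beta> - \<eta> * \<bar>real_of_int k\<bar>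
            = (\<eta> + \<beta>) * n + (\<beta> * (- real_of_int k) - \<eta> * (- real_of_int k))"
          using neg by (simp add: algebra_simps)
        ultimately show ?thesis by linarith
      qed
      then have "1 \<le> 2 powr (\<beta> + (\<eta> + \<beta>) * n + (- real_of_int k - 1) * \<beta> - \<eta> * \<bar>real_of_int k\<bar>)"
        using powr_mono[of 0 _ 2] by simp
      also have "\<dots> = (2 powr (- real_of_int k - 1)) powr \<beta> * ?c * K"
        by (simp add: K_def powr_powr algebra_simps flip: powr_add)
      also have "\<dots> \<le> d x y powr \<beta> * ?c * K"
        using d d0 assms(1) K by (intro mult_right_mono powr_mono2) auto
      finally have 1: "1 \<le> d x y powr \<beta> * ?c * K" .
      have "\<bar>u z\<bar> \<le> d x y powr \<beta> * (?c * \<Psi> z)" if "z \<in> space M - E'" for z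
      proof -
        have "1 * \<bar>u z\<bar> \<le> (d x y powr \<beta> * ?c * K) * \<bar>u z\<bar>"
          using 1 by (intro mult_right_mono) auto
        also have "\<dots> = d x y powr \<beta> * (?c * (K * \<bar>u z\<bar>))" by simp
        also have "\<dots> \<le> d x y powr \<beta> * (?c * \<Psi> z)"
          using \<Psi>u[OF that] by (intro mult_left_mono) auto
        finally show ?thesis by simp
      qed
      from this[OF xy(1)] this[OF xy(2)] show ?thesis
        by (simp add: distrib_left)
    qed
  qed
  show ?thesis
  proof (rule that[OF \<Psi>m])
    show "0 \<le> \<Psi> x" for x by (simp add: \<Psi>_def)
    show "(\<lambda>k x. 2 powr (- \<eta> * \<bar>real_of_int k\<bar>) * \<Psi> x) \<in> frac_gradients d M \<beta> u"
      using \<Psi>m by (intro frac_gradientsI[OF _ _ E'] grad) (simp_all add: \<Psi>_def)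
    have "ennreal (\<bar>\<Psi> x\<bar> powr p) \<le> P x" for x
      using assms(3) by (cases "P x") (auto simp: \<Psi>_def powr_powr)
    then have "power_integral M p \<Psi> \<le> (\<integral>\<^sup>+x. P x \<partial>M)"
      unfolding power_integral_def by (intro nn_integral_mono) auto
    also note Pint
    finally show "power_integral M p \<Psi> \<le> ennreal (2 powr (p * (\<beta> + (\<eta> + \<beta>) * n))) * power_integral M p u
        + ennreal ((2 powr (- \<eta> * p)) ^ n / (1 - 2 powr (- \<eta> * p))) * ennreal A"
      by (simp add: \<theta>_def)
  qed
qed


section \<open>Interpolation between $L^p$ and the Besov norm\<close>

lemma Lp_space_simps:
  "fst (Lp_space M p) = {u \<in> borel_measurable M. power_integral M p u < \<infinity>}"
  "snd (Lp_space M p) u = enn_powr (power_integral M p u) (1 / p)"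
proof -
  show "snd (Lp_space M p) u = enn_powr (power_integral M p u) (1 / p)" for u
    by (simp add: Lp_space_def Let_def Lp_norm_abs)
  have "enn_powr x (1 / p) < \<infinity> \<longleftrightarrow> x < \<infinity>" for x
    by (auto simp: enn_powr_def top.not_eq_extremum)
  then show "fst (Lp_space M p) = {u \<in> borel_measurable M. power_integral M p u < \<infinity>}"
    by (simp add: Lp_space_def Let_def Lp_norm_abs)
qed

lemma Hajlasz_space_carrier:
  assumes "B \<in> {Hajlasz_Triebel_Lizorkin d M \<beta> p r, Hajlasz_Besov d M \<beta> p r}"
  shows "fst B = {u \<in> fst (Lp_space M p). snd B u < \<infinity>}"
  using assms by (auto simp: Hajlasz_Triebel_Lizorkin_def Hajlasz_Besov_def Let_def)

lemma Lp_norm_le_Hajlasz_norm: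
  assumes "B \<in> {Hajlasz_Triebel_Lizorkin d M \<beta> p r, Hajlasz_Besov d M \<beta> p r}"
  shows "snd (Lp_space M p) u \<le> snd B u"
  using assms by (auto simp: Hajlasz_Triebel_Lizorkin_def Hajlasz_Besov_def Let_def)

text \<open>
  For a gradient that is a product of a sequence in \<open>k\<close> and a function of \<open>x\<close>, the order in which
  the $\ell^r$ and the $L^p$ norm are taken is immaterial, by homogeneity of both.
\<close>

lemma Hajlasz_norm_le_of_product_gradient:
  assumes "0 < p" "0 < r" and [measurable]: "\<Psi> \<in> borel_measurable M"
    and nonneg: "\<And>x. 0 \<le> \<Psi> x" "\<And>k. 0 \<le> c k"
    and grad: "(\<lambda>k x. c k * \<Psi> x) \<in> frac_gradients d M \<beta> u"
    and B: "B \<in> {Hajlasz_Triebel_Lizorkin d M \<beta> p r, Hajlasz_Besov d M \<beta> p r}"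
  shows "snd B u \<le> snd (Lp_space M p) u
    + lq_norm r (\<lambda>k. ennreal (c k)) * enn_powr (power_integral M p \<Psi>) (1 / p)"
proof -
  let ?L = "Lp_norm M p (\<lambda>x. ennreal (\<Psi> x))"
  have L: "?L = enn_powr (power_integral M p \<Psi>) (1 / p)"
    using nonneg by (intro Lp_norm_nonneg)
  have "Lp_norm M p (\<lambda>x. lq_norm r (\<lambda>k. ennreal (c k * \<Psi> x)))
      = lq_norm r (\<lambda>k. ennreal (c k)) * ?L"
    using assms(1,2) nonneg by (simp add: ennreal_mult lq_norm_multc Lp_norm_cmult)
  moreover have "lq_norm r (\<lambda>k. Lp_norm M p (\<lambda>x. ennreal (c k * \<Psi> x)))
      = lq_norm r (\<lambda>k. ennreal (c k)) * ?L"
    using assms(1,2) nonneg by (simp add: ennreal_mult lq_norm_multc Lp_norm_cmult)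
  ultimately show ?thesis
    using B INF_lower[OF grad, of "\<lambda>g. Lp_norm M p (\<lambda>x. lq_norm r (\<lambda>k. ennreal (g k x)))"]
      INF_lower[OF grad, of "\<lambda>g. lq_norm r (\<lambda>k. Lp_norm M p (\<lambda>x. ennreal (g k x)))"]
    unfolding L by (auto simp: Hajlasz_Triebel_Lizorkin_def Hajlasz_Besov_def Let_def intro!: add_left_mono)
qed

text \<open>
  The infimum over gradients need not be attained, whence the 1 added to the norm bound.
\<close>

lemma Besov_bounded_gradient:
  assumes "0 < p" "0 < q" "0 \<le> C" "snd (Hajlasz_Besov d M \<alpha> p q) u \<le> ennreal C"
  obtains g where "g \<in> frac_gradients d M \<alpha> u"
    "\<forall>k. power_integral M p (g k) \<le> ennreal ((C + 1) powr p)"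
proof -
  let ?N = "\<lambda>g. lq_norm q (\<lambda>k. Lp_norm M p (\<lambda>x. ennreal (g k x)))"
  have "(INF g\<in>frac_gradients d M \<alpha> u. ?N g) \<le> snd (Hajlasz_Besov d M \<alpha> p q) u"
    by (simp add: Hajlasz_Besov_def Let_def)
  also have "\<dots> < ennreal (C + 1)"
    using assms(3,4) by (intro le_less_trans[OF assms(4)]) (simp add: ennreal_less_iff)
  finally obtain g where g: "g \<in> frac_gradients d M \<alpha> u" "?N g < ennreal (C + 1)"
    by (auto simp: INF_less_iff)
  have "power_integral M p (g k) \<le> ennreal ((C + 1) powr p)" for k
  proof -
    have "enn_powr (power_integral M p (g k)) (1 / p) = Lp_norm M p (\<lambda>x. ennreal (g k x))"
      using frac_gradients_nonneg[OF g(1)] by (rule Lp_norm_nonneg[symmetric])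
    also have "\<dots> \<le> ?N g" by (rule le_lq_norm[OF assms(2)])
    also have "\<dots> \<le> ennreal (C + 1)" using g(2) by simp
    finally show ?thesis
      by (rule iffD1[OF enn_powr_root_le_iff, rotated 2]) (use assms(1,3) in auto)
  qed
  then show thesis using g(1) that by blast
qed

text \<open>
  The set-theoretic inclusion behind the embeddings: the decaying gradient with \<open>n = 0\<close> already has
  finite norm.
\<close>

lemma Hajlasz_norm_finite:
  assumes "0 < \<beta>" "\<beta> < \<alpha>" "0 < p" "0 < r"
    and B: "B \<in> {Hajlasz_Triebel_Lizorkin d M \<beta> p r, Hajlasz_Besov d M \<beta> p r}"
    and u: "u \<in> fst (Lp_space M p)" and g: "g \<in> frac_gradients d M \<alpha> u"
    and gA: "\<And>k. power_integral M p (g k) \<le> ennreal A"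
  shows "snd B u < \<infinity>"
proof -
  have um: "u \<in> borel_measurable M" and uf: "power_integral M p u < \<infinity>"
    using u by (auto simp: Lp_space_simps)
  define \<eta> where "\<eta> = min \<beta> (\<alpha> - \<beta>) / 2"
  have \<eta>: "0 < \<eta>" using assms by (simp add: \<eta>_def)
  obtain \<Psi> where \<Psi>: "\<Psi> \<in> borel_measurable M" "\<And>x. 0 \<le> \<Psi> x"
    "(\<lambda>k x. 2 powr (- \<eta> * \<bar>real_of_int k\<bar>) * \<Psi> x) \<in> frac_gradients d M \<beta> u"
    "power_integral M p \<Psi> \<le> ennreal (2 powr (p * (\<beta> + (\<eta> + \<beta>) * 0))) * power_integral M p u
        + ennreal ((2 powr (- \<eta> * p)) ^ 0 / (1 - 2 powr (- \<eta> * p))) * ennreal A"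
    using geometric_decay_gradient[OF assms(1-3) um uf g gA, of 0] unfolding \<eta>_def by auto
  note \<Psi>(4)
  also have "\<dots> < \<infinity>" using uf by (simp add: ennreal_mult_less_top)
  finally have "enn_powr (power_integral M p \<Psi>) (1 / p) < \<infinity>"
    by (auto simp: enn_powr_def)
  moreover have "enn_powr (power_integral M p u) (1 / p) < \<infinity>"
    using uf by (auto simp: enn_powr_def)
  moreover note lq_norm_geometric_finite[OF \<eta> assms(4)]
    Hajlasz_norm_le_of_product_gradient[OF assms(3,4) \<Psi>(1,2) _ \<Psi>(3) B]
  ultimately show ?thesis
    by (auto simp: Lp_space_simps ennreal_mult_less_top intro: le_less_trans)
qed

text \<open>
  The interpolation principle in the form needed for compactness. The target norm of \<open>w\<close> is at most
  its $L^p$ norm plus \<open>c\<close> times the $L^p$ norm of \<open>\<Psi>\<close>, and each part is made at most \<open>\<epsilon>/3\<close>. The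
  order of choices matters: first \<open>n\<close>, depending on \<open>A\<close> and \<open>\<epsilon>\<close>, makes the contribution of the
  gradient small; only then is \<open>\<delta>\<close> chosen, because the factor \<open>K\<close> on the $L^p$ part grows with \<open>n\<close>.
\<close>

lemma Hajlasz_norm_small:
  assumes "0 < \<beta>" "\<beta> < \<alpha>" "0 < p" "0 < r" "0 < \<epsilon>" "0 \<le> A"
    and B: "B \<in> {Hajlasz_Triebel_Lizorkin d M \<beta> p r, Hajlasz_Besov d M \<beta> p r}"
  obtains \<delta> where "0 < \<delta>"
    "\<And>w g. \<lbrakk>w \<in> borel_measurable M; g \<in> frac_gradients d M \<alpha> w;
        \<And>k. power_integral M p (g k) \<le> ennreal A; power_integral M p w \<le> ennreal \<delta>\<rbrakk>
      \<Longrightarrow> snd B w < ennreal \<epsilon>"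
proof -
  define \<eta> where "\<eta> = min \<beta> (\<alpha> - \<beta>) / 2"
  have \<eta>: "0 < \<eta>" using assms by (simp add: \<eta>_def)
  define \<theta> where "\<theta> = 2 powr (- \<eta> * p)"
  have \<theta>: "0 < \<theta>" "\<theta> < 1"
    using \<eta> assms(3) powr_less_mono[of "- \<eta> * p" 0 2] by (auto simp: \<theta>_def)
  obtain c where c: "0 \<le> c" "lq_norm r (\<lambda>k. ennreal (2 powr (- \<eta> * \<bar>real_of_int k\<bar>))) = ennreal c"
    using lq_norm_geometric_finite[OF \<eta> assms(4)] by (cases rule: ennreal_cases) auto
  \<comment> \<open>Adding 1 to \<open>c\<close> only avoids a division by zero.\<close>
  define \<sigma> where "\<sigma> = \<epsilon> / (3 * (c + 1))"
  have \<sigma>: "0 < \<sigma>" "c * \<sigma> \<le> \<epsilon> / 3"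
    using c assms(5) by (auto simp: \<sigma>_def field_simps)
  define \<tau> where "\<tau> = \<sigma> powr p"
  have \<tau>: "0 < \<tau>" using \<sigma> by (simp add: \<tau>_def)
  obtain n where n: "\<theta> ^ n < \<tau> / 2 * (1 - \<theta>) / (A + 1)"
    using real_arch_pow_inv[of "\<tau> / 2 * (1 - \<theta>) / (A + 1)" \<theta>] \<tau> \<theta> assms(6) by auto
  have tail: "\<theta> ^ n / (1 - \<theta>) * A \<le> \<tau> / 2"
  proof -
    have "\<theta> ^ n * (A + 1) \<le> \<tau> / 2 * (1 - \<theta>)"
      using n assms(6) pos_less_divide_eq[of "A + 1" "\<theta> ^ n" "\<tau> / 2 * (1 - \<theta>)"] by auto
    moreover have "\<theta> ^ n * A \<le> \<theta> ^ n * (A + 1)"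
      using \<theta> by (intro mult_left_mono) auto
    ultimately have "\<theta> ^ n * A \<le> \<tau> / 2 * (1 - \<theta>)" by (rule order_trans[rotated])
    then have "\<theta> ^ n * A / (1 - \<theta>) \<le> \<tau> / 2" using \<theta> by (subst pos_divide_le_eq) auto
    then show ?thesis by simp
  qed
  define K where "K = 2 powr (p * (\<beta> + (\<eta> + \<beta>) * n))"
  have K: "0 < K" by (simp add: K_def)
  define \<delta> where "\<delta> = min ((\<epsilon> / 3) powr p) (\<tau> / 2 / K)"
  have \<delta>: "0 < \<delta>" "\<delta> \<le> (\<epsilon> / 3) powr p" "K * \<delta> \<le> \<tau> / 2"
    using assms(5) \<tau> K by (auto simp: \<delta>_def min_def field_simps)
  have "snd B w < ennreal \<epsilon>"
    if w: "w \<in> borel_measurable M" and g: "g \<in> frac_gradients d M \<alpha> w"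
      and gA: "\<And>k. power_integral M p (g k) \<le> ennreal A"
      and w\<delta>: "power_integral M p w \<le> ennreal \<delta>" for w g
  proof -
    have wf: "power_integral M p w < \<infinity>" using w\<delta> by (auto intro: le_less_trans)
    obtain \<Psi> where \<Psi>: "\<Psi> \<in> borel_measurable M" "\<And>x. 0 \<le> \<Psi> x"
      "(\<lambda>k x. 2 powr (- \<eta> * \<bar>real_of_int k\<bar>) * \<Psi> x) \<in> frac_gradients d M \<beta> w"
      "power_integral M p \<Psi> \<le> ennreal K * power_integral M p w + ennreal (\<theta> ^ n / (1 - \<theta>)) * ennreal A"
      using geometric_decay_gradient[OF assms(1-3) w wf g gA, of n]
      unfolding \<eta>_def \<theta>_def K_def by blast
    note \<Psi>(4)
    also have "\<dots> \<le> ennreal K * ennreal \<delta> + ennreal (\<theta> ^ n / (1 - \<theta>)) * ennreal A"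
      using w\<delta> by (intro add_mono mult_left_mono) auto
    also have "\<dots> = ennreal (K * \<delta> + \<theta> ^ n / (1 - \<theta>) * A)"
    proof -
      have "0 \<le> K" "0 \<le> \<delta>" "0 \<le> \<theta> ^ n / (1 - \<theta>)" using K \<delta>(1) \<theta> by auto
      then show ?thesis using assms(6) by (simp only: ennreal_plus ennreal_mult mult_nonneg_nonneg)
    qed
    also have "\<dots> \<le> ennreal \<tau>" using \<delta>(3) tail by (intro ennreal_leI) linarith
    finally have "enn_powr (power_integral M p \<Psi>) (1 / p) \<le> ennreal \<sigma>"
      using assms(3) \<sigma> by (simp add: enn_powr_root_le_iff \<tau>_def)
    then have "ennreal c * enn_powr (power_integral M p \<Psi>) (1 / p) \<le> ennreal c * ennreal \<sigma>"
      by (rule mult_left_mono) simp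
    also have "\<dots> = ennreal (c * \<sigma>)" using c \<sigma> by (simp add: ennreal_mult)
    also have "\<dots> \<le> ennreal (\<epsilon> / 3)" using \<sigma> by (intro ennreal_leI) simp
    finally have grad_part: "ennreal c * enn_powr (power_integral M p \<Psi>) (1 / p) \<le> ennreal (\<epsilon> / 3)" .
    have "power_integral M p w \<le> ennreal ((\<epsilon> / 3) powr p)"
      using w\<delta> \<delta>(2) by (meson ennreal_leI order_trans)
    then have Lp_part: "enn_powr (power_integral M p w) (1 / p) \<le> ennreal (\<epsilon> / 3)"
      using assms(3,5) by (simp add: enn_powr_root_le_iff)
    have "snd B w \<le> enn_powr (power_integral M p w) (1 / p)
        + ennreal c * enn_powr (power_integral M p \<Psi>) (1 / p)"
      using Hajlasz_norm_le_of_product_gradient[OF assms(3,4) \<Psi>(1,2) _ \<Psi>(3) B]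
      unfolding c(2) Lp_space_simps(2) by simp
    also have "\<dots> \<le> ennreal (\<epsilon> / 3) + ennreal (\<epsilon> / 3)"
      using Lp_part grad_part by (rule add_mono)
    also have "\<dots> < ennreal \<epsilon>"
      using assms(5) by (simp add: ennreal_less_iff flip: ennreal_plus)
    finally show ?thesis .
  qed
  then show thesis using that[of \<delta>] \<delta>(1) by blast
qed

section \<open>Compact embeddings\<close>

lemma totally_bounded_in_net:
  assumes "totally_bounded_in A S" "0 < \<epsilon>"
  obtains F where "finite F" "F \<subseteq> fst A" "\<forall>u\<in>S. \<exists>v\<in>F. snd A (\<lambda>x. u x - v x) < ennreal \<epsilon>"
proof -
  from assms have "\<exists>F. finite F \<and> F \<subseteq> fst A \<and> (\<forall>u\<in>S. \<exists>v\<in>F. snd A (\<lambda>x. u x - v x) < ennreal \<epsilon>)"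
    unfolding totally_bounded_in_def by simp
  then show thesis using that by (elim exE conjE)
qed

lemma compact_embedding_weaker_norm:
  assumes "compact_embedding A B" "fst B \<subseteq> fst L" "\<And>u. snd L u \<le> snd B u"
  shows "compact_embedding A L"
  unfolding compact_embedding_def
proof (intro conjI allI impI)
  show "fst A \<subseteq> fst L" using assms(1,2) by (auto simp: compact_embedding_def)
  fix S assume "bounded_in A S"
  then have S: "totally_bounded_in B S" using assms(1) by (simp add: compact_embedding_def)
  show "totally_bounded_in L S"
    unfolding totally_bounded_in_def
  proof (intro conjI allI impI)
    show "S \<subseteq> fst L" using S assms(2) by (auto simp: totally_bounded_in_def)
    fix \<epsilon> :: real assume "0 < \<epsilon>"
    then obtain F where "finite F" "F \<subseteq> fst B"
      and F: "\<forall>u\<in>S. \<exists>v\<in>F. snd B (\<lambda>x. u x - v x) < ennreal \<epsilon>"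
      by (rule totally_bounded_in_net[OF S])
    moreover have "\<forall>u\<in>S. \<exists>v\<in>F. snd L (\<lambda>x. u x - v x) < ennreal \<epsilon>"
      using F le_less_trans[OF assms(3)] by blast
    ultimately show "\<exists>F. finite F \<and> F \<subseteq> fst L \<and> (\<forall>u\<in>S. \<exists>v\<in>F. snd L (\<lambda>x. u x - v x) < ennreal \<epsilon>)"
      using assms(2) by blast
  qed
qed

text \<open>
  If closeness in $L^p$ implies closeness in \<open>B\<close> for pairs of points from a bounded set of \<open>A\<close>, then
  $L^p$ nets yield nets in \<open>B\<close>. The centres supplied by total boundedness lie in $L^p$ only and may
  have no smoothness at all, so each useful centre is first replaced by a nearby element of the set.
\<close>

lemma compact_embedding_from_Lp:
  assumes comp: "compact_embedding A (Lp_space M p)" and "0 < p" and sub: "fst A \<subseteq> fst B"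
    and small: "\<And>C \<epsilon> :: real. 0 < \<epsilon> \<Longrightarrow> \<exists>\<delta>>0. \<forall>u\<in>fst A. \<forall>v\<in>fst A.
      snd A u \<le> ennreal C \<longrightarrow> snd A v \<le> ennreal C \<longrightarrow>
      power_integral M p (\<lambda>x. u x - v x) \<le> ennreal \<delta> \<longrightarrow> snd B (\<lambda>x. u x - v x) < ennreal \<epsilon>"
  shows "compact_embedding A B"
  unfolding compact_embedding_def
proof (intro conjI allI impI sub)
  fix S assume "bounded_in A S"
  then obtain C :: real where SA: "S \<subseteq> fst A" and C: "\<forall>u\<in>S. snd A u \<le> ennreal C"
    by (auto simp: bounded_in_def)
  have S: "totally_bounded_in (Lp_space M p) S"
    using \<open>bounded_in A S\<close> comp by (simp add: compact_embedding_def)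
  then have SL: "S \<subseteq> fst (Lp_space M p)" by (simp add: totally_bounded_in_def)
  show "totally_bounded_in B S"
    unfolding totally_bounded_in_def
  proof (intro conjI allI impI)
    show "S \<subseteq> fst B" using SA sub by blast
    fix \<epsilon> :: real assume "0 < \<epsilon>"
    from small[OF this, of C] obtain \<delta> where \<delta>: "0 < \<delta>"
      and close: "\<And>u v. \<lbrakk>u \<in> S; v \<in> S; power_integral M p (\<lambda>x. u x - v x) \<le> ennreal \<delta>\<rbrakk>
        \<Longrightarrow> snd B (\<lambda>x. u x - v x) < ennreal \<epsilon>"
      using SA C by blast
    \<comment> \<open>Two points within \<open>\<rho>\<close> of a common centre are within \<open>\<delta>\<close> of each other, distances being
      measured by the \<open>p\<close>-th power of the $L^p$ quasi-norm.\<close>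
    define \<rho> where "\<rho> = \<delta> / (2 * 2 powr p)"
    have \<rho>: "0 < \<rho>" "2 powr p * (\<rho> + \<rho>) = \<delta>" using \<delta> by (auto simp: \<rho>_def)
    let ?near = "\<lambda>v u. power_integral M p (\<lambda>x. u x - v x) \<le> ennreal \<rho>"
    have "0 < \<rho> powr (1 / p)" using \<rho> by simp
    then obtain F where F: "finite F" "F \<subseteq> fst (Lp_space M p)"
      and cover: "\<forall>u\<in>S. \<exists>v\<in>F. snd (Lp_space M p) (\<lambda>x. u x - v x) < ennreal (\<rho> powr (1 / p))"
      by (rule totally_bounded_in_net[OF S])
    have near: "\<exists>v\<in>F. ?near v u" if u: "u \<in> S" for u
    proof -
      obtain v where v: "v \<in> F" "snd (Lp_space M p) (\<lambda>x. u x - v x) < ennreal (\<rho> powr (1 / p))"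
        using bspec[OF cover u] by (elim bexE)
      have "?near v u"
        using less_imp_le[OF v(2)] assms(2) \<rho>(1)
        by (simp add: Lp_space_simps(2) enn_powr_root_le_iff powr_powr)
      then show ?thesis using v(1) by (rule bexI)
    qed
    define rep where "rep v = (SOME w. w \<in> S \<and> ?near v w)" for v
    define G where "G = rep ` {v \<in> F. \<exists>w\<in>S. ?near v w}"
    have rep: "rep v \<in> S" "?near v (rep v)" if "w \<in> S" "?near v w" for v w
      using someI[of "\<lambda>w. w \<in> S \<and> ?near v w" w] that by (auto simp: rep_def)
    have GS: "G \<subseteq> S" using rep by (auto simp: G_def)
    show "\<exists>F. finite F \<and> F \<subseteq> fst B \<and> (\<forall>u\<in>S. \<exists>v\<in>F. snd B (\<lambda>x. u x - v x) < ennreal \<epsilon>)"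
    proof (intro exI[of _ G] conjI ballI)
      show "finite G" using F(1) by (simp add: G_def)
      show "G \<subseteq> fst B" using GS SA sub by blast
      fix u assume u: "u \<in> S"
      then obtain v where v: "v \<in> F" "?near v u" by (elim bexE[OF near])
      have [measurable]: "u \<in> borel_measurable M" "v \<in> borel_measurable M" "rep v \<in> borel_measurable M"
        using u v F(2) SL rep(1)[OF u v(2)] by (auto simp: Lp_space_simps)
      have "power_integral M p (\<lambda>x. u x - rep v x) \<le> ennreal (2 powr p) *
          (power_integral M p (\<lambda>x. u x - v x) + power_integral M p (\<lambda>x. rep v x - v x))"
        using assms(2) by (intro power_integral_add_le) auto
      also have "\<dots> \<le> ennreal (2 powr p) * (ennreal \<rho> + ennreal \<rho>)"
        using v(2) rep(2)[OF u v(2)] by (intro mult_left_mono add_mono) auto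
      also have "\<dots> = ennreal \<delta>"
        using \<rho> by (simp flip: ennreal_plus ennreal_mult)
      finally have "snd B (\<lambda>x. u x - rep v x) < ennreal \<epsilon>"
        using u rep(1)[OF u v(2)] by (intro close)
      moreover have "rep v \<in> G" unfolding G_def using u v by (intro imageI CollectI conjI bexI[of _ u])
      ultimately show "\<exists>v\<in>G. snd B (\<lambda>x. u x - v x) < ennreal \<epsilon>" by (rule bexI)
    qed
  qed
qed

text \<open>
  The difference of two functions of norm at most \<open>D\<close> has a gradient whose scales are bounded in
  $L^p$ independently of the two functions, so the interpolation principle turns $L^p$ closeness
  into closeness in \<open>B\<close>.
\<close>

lemma compact_embedding_Besov_of_Lp:
  assumes "0 < \<beta>" "\<beta> < \<alpha>" "0 < p" "0 < q" "0 < r"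
    and B: "B \<in> {Hajlasz_Triebel_Lizorkin d M \<beta> p r, Hajlasz_Besov d M \<beta> p r}"
    and comp: "compact_embedding (Hajlasz_Besov d M \<alpha> p q) (Lp_space M p)"
  shows "compact_embedding (Hajlasz_Besov d M \<alpha> p q) B"
proof (rule compact_embedding_from_Lp[OF comp \<open>0 < p\<close>])
  let ?A = "Hajlasz_Besov d M \<alpha> p q"
  have A: "fst ?A = {u \<in> fst (Lp_space M p). snd ?A u < \<infinity>}"
    by (rule Hajlasz_space_carrier[where d = d and \<beta> = \<alpha> and r = q]) simp
  show "fst ?A \<subseteq> fst B"
  proof
    fix u assume "u \<in> fst ?A"
    then have u: "u \<in> fst (Lp_space M p)" "snd ?A u < \<infinity>" using A by auto
    then obtain C where C: "0 \<le> C" "snd ?A u = ennreal C"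
      by (cases "snd ?A u" rule: ennreal_cases) auto
    then obtain g where "g \<in> frac_gradients d M \<alpha> u"
      "\<forall>k. power_integral M p (g k) \<le> ennreal ((C + 1) powr p)"
      using Besov_bounded_gradient[OF assms(3,4) C(1)] by (metis order_refl)
    then have "snd B u < \<infinity>"
      using Hajlasz_norm_finite[OF assms(1-3,5) B u(1)] by blast
    then show "u \<in> fst B" using Hajlasz_space_carrier[OF B] u(1) by auto
  qed
  fix C \<epsilon> :: real assume "0 < \<epsilon>"
  define D where "D = max C 0"
  define A where "A = 2 powr p * ((D + 1) powr p + (D + 1) powr p)"
  have "0 \<le> A" by (simp add: A_def)
  from Hajlasz_norm_small[OF assms(1-3,5) \<open>0 < \<epsilon>\<close> this B]
  obtain \<delta> where "0 < \<delta>" and \<delta>: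
    "\<And>w g. \<lbrakk>w \<in> borel_measurable M; g \<in> frac_gradients d M \<alpha> w;
        \<And>k. power_integral M p (g k) \<le> ennreal A; power_integral M p w \<le> ennreal \<delta>\<rbrakk>
      \<Longrightarrow> snd B w < ennreal \<epsilon>" by blast
  have "snd B (\<lambda>x. u x - v x) < ennreal \<epsilon>"
    if uv: "u \<in> fst ?A" "v \<in> fst ?A" and C: "snd ?A u \<le> ennreal C" "snd ?A v \<le> ennreal C"
      and close: "power_integral M p (\<lambda>x. u x - v x) \<le> ennreal \<delta>" for u v
  proof -
    have [measurable]: "u \<in> borel_measurable M" "v \<in> borel_measurable M"
      using uv A by (auto simp: Lp_space_simps)
    \<comment> \<open>A negative \<open>C\<close> is truncated to 0 by the coercion, hence the maximum in \<open>D\<close>.\<close>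
    have D: "0 \<le> D" "snd ?A u \<le> ennreal D" "snd ?A v \<le> ennreal D"
      using C by (auto simp: D_def max_def ennreal_neg)
    obtain g where g: "g \<in> frac_gradients d M \<alpha> u"
      "\<forall>k. power_integral M p (g k) \<le> ennreal ((D + 1) powr p)"
      by (rule Besov_bounded_gradient[OF assms(3,4) D(1,2)])
    obtain h where h: "h \<in> frac_gradients d M \<alpha> v"
      "\<forall>k. power_integral M p (h k) \<le> ennreal ((D + 1) powr p)"
      by (rule Besov_bounded_gradient[OF assms(3,4) D(1,3)])
    note [measurable] = frac_gradients_measurable[OF g(1)] frac_gradients_measurable[OF h(1)]
    have "power_integral M p (\<lambda>x. g k x + h k x) \<le> ennreal A" for k
    proof -
      have "power_integral M p (\<lambda>x. g k x + h k x)
          \<le> ennreal (2 powr p) * (power_integral M p (g k) + power_integral M p (h k))"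
        using assms(3) by (intro power_integral_add_le) auto
      also have "\<dots> \<le> ennreal (2 powr p) * (ennreal ((D + 1) powr p) + ennreal ((D + 1) powr p))"
        using g(2) h(2) by (intro mult_left_mono add_mono) auto
      also have "\<dots> = ennreal A" by (simp add: A_def flip: ennreal_plus ennreal_mult)
      finally show ?thesis .
    qed
    then show ?thesis
      using close by (intro \<delta>[OF _ frac_gradients_diff[OF g(1) h(1)]]) auto
  qed
  then show "\<exists>\<delta>>0. \<forall>u\<in>fst ?A. \<forall>v\<in>fst ?A. snd ?A u \<le> ennreal C \<longrightarrow> snd ?A v \<le> ennreal C \<longrightarrow>
      power_integral M p (\<lambda>x. u x - v x) \<le> ennreal \<delta> \<longrightarrow> snd B (\<lambda>x. u x - v x) < ennreal \<epsilon>"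
    using \<open>0 < \<delta>\<close> by blast
qed

lemma compact_embedding_Lp_of_Hajlasz:
  assumes B: "B \<in> {Hajlasz_Triebel_Lizorkin d M \<beta> p r, Hajlasz_Besov d M \<beta> p r}"
    and "compact_embedding A B"
  shows "compact_embedding A (Lp_space M p)"
  using assms(2)
proof (rule compact_embedding_weaker_norm)
  show "fst B \<subseteq> fst (Lp_space M p)" using Hajlasz_space_carrier[OF B] by auto
qed (rule Lp_norm_le_Hajlasz_norm[OF B])

theorem theorem7p2:
  fixes X :: "'a set" and d :: "'a \<Rightarrow> 'a \<Rightarrow> real" and M :: "'a measure"
    and \<alpha> p :: real and q :: ennreal
  assumes "quasi_metric_measure_space X d M"
    and "0 < \<alpha>" and "0 < p" and "0 < q"
  shows
    "(compact_embedding (Hajlasz_Besov d M \<alpha> p q) (Lp_space M p)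
      \<longleftrightarrow>
      (\<forall>\<beta>::real. \<forall>r::ennreal. 0 < \<beta> \<and> \<beta> < \<alpha> \<and> 0 < r \<longrightarrow>
         compact_embedding (Hajlasz_Besov d M \<alpha> p q) (Hajlasz_Triebel_Lizorkin d M \<beta> p r) \<and>
         compact_embedding (Hajlasz_Besov d M \<alpha> p q) (Hajlasz_Besov d M \<beta> p r)))
     \<and>
     ((\<forall>\<beta>::real. \<forall>r::ennreal. 0 < \<beta> \<and> \<beta> < \<alpha> \<and> 0 < r \<longrightarrow>
         compact_embedding (Hajlasz_Besov d M \<alpha> p q) (Hajlasz_Triebel_Lizorkin d M \<beta> p r) \<and>
         compact_embedding (Hajlasz_Besov d M \<alpha> p q) (Hajlasz_Besov d M \<beta> p r))
      \<longleftrightarrow>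
      (\<exists>\<beta>::real. \<exists>r::ennreal. 0 < \<beta> \<and> \<beta> < \<alpha> \<and> 0 < r \<and>
         (compact_embedding (Hajlasz_Besov d M \<alpha> p q) (Hajlasz_Triebel_Lizorkin d M \<beta> p r) \<or>
          compact_embedding (Hajlasz_Besov d M \<alpha> p q) (Hajlasz_Besov d M \<beta> p r))))"
  (is "(?P \<longleftrightarrow> ?Q) \<and> (?Q \<longleftrightarrow> ?R)")
proof -
  have PQ: "?P \<Longrightarrow> ?Q"
    using compact_embedding_Besov_of_Lp assms(3,4) by blast
  have QR: "?Q \<Longrightarrow> ?R"
  proof -
    assume ?Q
    moreover have "0 < \<alpha> / 2 \<and> \<alpha> / 2 < \<alpha> \<and> (0::ennreal) < 1" using assms(2) by simp
    ultimately show ?R by blast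
  qed
  have "?R \<Longrightarrow> ?P"
    using compact_embedding_Lp_of_Hajlasz by blast
  with PQ QR show ?thesis by blast
qed

end
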